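(* Let $m\ge 2$ and $n_1,\dots,n_m\ge 1$ be integers, $N=\sum_{i=1}^m n_i$, and let $G=K_{n_1,\dots,n_m}$ be the complete $m$-partite graph with parts of sizes $n_1,\dots,n_m$. Let $S(n_1,\dots,n_m)$ be the number of words of length $N$ over $[m]=\{1,\dots,m\}$ using color $i$ exactly $n_i$ times, with no two consecutive equal letters and with distinct first and last letters. Then the number of undirected Hamiltonian cycles of $G$ is \[ H(n_1,\dots,n_m)=\frac{\prod_{i=1}^m (n_i!)}{2N}\,S(n_1,\dots,n_m). \]
   Formalization: The formal theorem additionally assumes N ≥ 3, excluding only m = 2, n_1 = n_2 = 1 (the graph K_2), where S(1,1) = 2 makes the right-hand side 1/2, so the stated formula fails. *)

theory Defs
  imports Complex_Main
begin

text \<open>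
  An undirected simple graph is given by its vertex set and its set of edges, an edge being a
  two-element set of vertices. The sizes are \<open>n 1, \<dots>, n m\<close>; the values of \<open>n\<close> outside \<open>{1..m}\<close>
  are never used. The vertex \<open>(i, j)\<close> is the \<open>j\<close>-th vertex of part \<open>i\<close>.
\<close>

definition multipartite_verts :: "nat \<Rightarrow> (nat \<Rightarrow> nat) \<Rightarrow> (nat \<times> nat) set" where
  "multipartite_verts m n = (SIGMA i:{1..m}. {..<n i})"

definition complete_multipartite_edges :: "nat \<Rightarrow> (nat \<Rightarrow> nat) \<Rightarrow> (nat \<times> nat) set set" where
  "complete_multipartite_edges m n =
     {{u, v} | u v. u \<in> multipartite_verts m n \<and> v \<in> multipartite_verts m n \<and> fst u \<noteq> fst v}"

definition closed_walk_edges :: "'a list \<Rightarrow> 'a set set" where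
  "closed_walk_edges vs = {{vs ! i, vs ! (Suc i mod length vs)} | i. i < length vs}"

text \<open>
  A Hamiltonian cycle is identified with its edge set (it spans all vertices), so neither a
  starting vertex nor a direction is recorded. As usual in simple graphs, a cycle has at least
  three vertices.
\<close>

definition hamiltonian_cycle :: "'a set \<Rightarrow> 'a set set \<Rightarrow> 'a set set \<Rightarrow> bool" where
  "hamiltonian_cycle V E C \<longleftrightarrow>
     C \<subseteq> E \<and>
     (\<exists>vs. 3 \<le> length vs \<and> distinct vs \<and> set vs = V \<and> C = closed_walk_edges vs)"

definition num_hamiltonian_cycles :: "'a set \<Rightarrow> 'a set set \<Rightarrow> nat" where
  "num_hamiltonian_cycles V E = card {C. hamiltonian_cycle V E C}"

definition cyclic_proper_words :: "nat \<Rightarrow> (nat \<Rightarrow> nat) \<Rightarrow> nat list set" where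
  "cyclic_proper_words m n =
     {w. length w = (\<Sum>i=1..m. n i) \<and> set w \<subseteq> {1..m} \<and>
         (\<forall>i\<in>{1..m}. count_list w i = n i) \<and>
         distinct_adj w \<and> hd w \<noteq> last w}"

end

theory Submission
  imports Defs
begin

text \<open>
  Count the vertex lists that traverse a Hamiltonian cycle in two ways. Their colour sequences
  are exactly the cyclically proper words, and each word lifts to \<open>\<Prod>i. n i!\<close> lists. On the other
  hand, every vertex of a cycle has degree two, so a traversal of a given cycle is determined by
  its first two vertices, and these range over the \<open>2 * N\<close> orientations of edges of the cycle.
\<close>

section \<open>Lifting a colour word to lists of vertices\<close>

definition lifts :: "'a set \<Rightarrow> ('a \<Rightarrow> 'b set) \<Rightarrow> 'a list \<Rightarrow> ('a \<times> 'b) list set" where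
  "lifts I F w = {xs. map fst xs = w \<and> distinct xs \<and> set xs = Sigma I F}"

text \<open>The recursion uses up the vertex \<open>(a, x)\<close>. It is the reason for allowing
  arbitrary fibres \<open>F\<close>: removing a point from \<open>{..<n a}\<close> need not leave an
  initial segment.\<close>

lemma lifts_Cons:
  assumes "a \<in> I"
  shows "lifts I F (a # w) = (\<Union>x\<in>F a. (#) (a, x) ` lifts I (F(a := F a - {x})) w)"
proof (intro equalityI subsetI)
  fix ys assume ys: "ys \<in> lifts I F (a # w)"
  then obtain p xs where ys_eq: "ys = p # xs" "fst p = a" "map fst xs = w"
    by (auto simp: lifts_def map_eq_Cons_conv)
  obtain x where p: "p = (a, x)" using ys_eq by (cases p) auto
  have *: "distinct xs" "(a, x) \<notin> set xs" "insert (a, x) (set xs) = Sigma I F"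
    using ys by (auto simp: lifts_def ys_eq p)
  have "set xs = Sigma I F - {(a, x)}" using * by auto
  also have "\<dots> = Sigma I (F(a := F a - {x}))" by (auto split: if_splits)
  finally have "xs \<in> lifts I (F(a := F a - {x})) w" using * ys_eq by (simp add: lifts_def)
  moreover have "x \<in> F a" using * by auto
  ultimately show "ys \<in> (\<Union>x\<in>F a. (#) (a, x) ` lifts I (F(a := F a - {x})) w)"
    using ys_eq p by auto
next
  fix ys assume "ys \<in> (\<Union>x\<in>F a. (#) (a, x) ` lifts I (F(a := F a - {x})) w)"
  then obtain x xs where *: "x \<in> F a" "ys = (a, x) # xs" "map fst xs = w" "distinct xs"
      "set xs = Sigma I (F(a := F a - {x}))"
    by (auto simp: lifts_def)
  have "Sigma I (F(a := F a - {x})) = Sigma I F - {(a, x)}" by (auto split: if_splits)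
  then show "ys \<in> lifts I F (a # w)" using * assms by (auto simp: lifts_def)
qed

lemma finite_lifts:
  assumes "finite I" "\<And>i. i \<in> I \<Longrightarrow> finite (F i)"
  shows "finite (lifts I F w)"
proof (rule finite_subset)
  show "lifts I F w \<subseteq> {xs. set xs \<subseteq> Sigma I F \<and> length xs = length w}"
    by (auto simp: lifts_def)
  show "finite {xs. set xs \<subseteq> Sigma I F \<and> length xs = length w}"
    using assms by (intro finite_lists_length_eq finite_SigmaI) auto
qed

text \<open>The first letter \<open>a\<close> can be lifted in \<open>card (F a)\<close> ways, and
  each choice shrinks the fibre over \<open>a\<close> by one point. The successive choices within
  one colour multiply to a factorial. The induction keeps \<open>F\<close> arbitrary because the
  fibres change.\<close>

lemma card_lifts:
  assumes "finite I" "set w \<subseteq> I" "\<And>i. i \<in> I \<Longrightarrow> finite (F i)"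
    and "\<And>i. i \<in> I \<Longrightarrow> count_list w i = card (F i)"
  shows "card (lifts I F w) = (\<Prod>i\<in>I. fact (card (F i)))"
  using assms
proof (induction w arbitrary: F)
  case Nil
  then have "Sigma I F = {}" by auto
  then have "lifts I F [] = {[]}" by (auto simp: lifts_def)
  \<comment> \<open>Read backwards, \<open>Nil(4)\<close> turns each \<open>card (F i)\<close> into
    a count in the empty word, so every factor is \<open>fact 0\<close>.\<close>
  moreover have "(\<Prod>i\<in>I. fact (card (F i))) = (\<Prod>i\<in>I. (1::nat))"
    using Nil by (intro prod.cong) (auto simp flip: Nil(4))
  ultimately show ?case by simp
next
  case (Cons a w)
  have a: "a \<in> I" using Cons.prems by simp
  let ?F = "\<lambda>x. F(a := F a - {x})"
  let ?P = "\<Prod>i\<in>I - {a}. fact (card (F i)) :: nat"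
  have card_a: "card (F a) = Suc (count_list w a)" using Cons.prems(4)[OF a] by simp
  have IH: "card (lifts I (?F x) w) = fact (count_list w a) * ?P" if x: "x \<in> F a" for x
  proof -
    have cx: "card (F a - {x}) = count_list w a"
      using card_a x Cons.prems(3)[OF a] by simp
    have "card (lifts I (?F x) w) = (\<Prod>i\<in>I. fact (card (?F x i)))"
    proof (rule Cons.IH)
      show "count_list w i = card (?F x i)" if "i \<in> I" for i
        using Cons.prems(4)[OF that] cx by (auto split: if_splits)
    qed (use Cons.prems in auto)
    also have "\<dots> = fact (count_list w a) * ?P"
      using a Cons.prems(1) cx by (subst prod.remove[of _ a]) (auto intro!: prod.cong)
    finally show ?thesis .
  qed
  \<comment> \<open>The union is disjoint because lists built from different \<open>x\<close> differ
    in their first entry.\<close>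
  have "card (lifts I F (a # w)) = (\<Sum>x\<in>F a. card ((#) (a, x) ` lifts I (?F x) w))"
    unfolding lifts_Cons[OF a]
  proof (rule card_UN_disjoint)
    show "\<forall>x\<in>F a. finite ((#) (a, x) ` lifts I (?F x) w)"
      using Cons.prems by (auto intro!: finite_lifts)
  qed (use Cons.prems(3)[OF a] in auto)
  also have "\<dots> = card (F a) * (fact (count_list w a) * ?P)"
    using IH by (simp add: card_image inj_on_def)
  \<comment> \<open>With \<open>c = count_list w a\<close> this is
    \<open>Suc c * fact c = fact (Suc c)\<close>, once the factor at \<open>a\<close> is split
    off.\<close>
  also have "\<dots> = (\<Prod>i\<in>I. fact (card (F i)))"
    using a Cons.prems(1) card_a by (subst (2) prod.remove[of _ a]) (auto simp: algebra_simps)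
  finally show ?case .
qed

lemma count_list_map_fst:
  assumes "distinct xs" "set xs = Sigma I F" "i \<in> I"
  shows "count_list (map fst xs) i = card (F i)"
proof -
  have "count_list (map fst xs) i = length (filter (\<lambda>p. fst p = i) xs)"
    by (induction xs) auto
  also have "\<dots> = card (set (filter (\<lambda>p. fst p = i) xs))"
    using assms by (metis distinct_card distinct_filter)
  also have "set (filter (\<lambda>p. fst p = i) xs) = Pair i ` F i" using assms by auto
  finally show ?thesis by (simp add: card_image inj_on_def)
qed

section \<open>Edge sets of closed walks\<close>

lemma mem_closed_walk_edges_iff:
  assumes "distinct vs" "a < length vs" "b < length vs"
  shows "{vs ! a, vs ! b} \<in> closed_walk_edges vs \<longleftrightarrow>
    b = Suc a mod length vs \<or> a = Suc b mod length vs"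
proof -
  have "length vs > 0" using assms by linarith
  then have lt: "Suc i mod length vs < length vs" for i by simp
  \<comment> \<open>Distinct entries make indexing injective, so equal pairs of vertices come from
    equal pairs of indices. The two disjuncts are the two cyclic neighbours of \<open>a\<close>:
    every vertex has degree two.\<close>
  show ?thesis
    using assms lt by (auto simp: closed_walk_edges_def doubleton_eq_iff nth_eq_iff_index_eq)
qed

text \<open>The cyclic condition splits by index: below \<open>length w - 1\<close> it compares
  adjacent letters, and at \<open>length w - 1\<close> the successor wraps to 0 and compares last
  with first.\<close>

lemma distinct_adj_hd_last_iff:
  assumes "w \<noteq> []"
  shows "distinct_adj w \<and> hd w \<noteq> last w \<longleftrightarrow>
    (\<forall>i<length w. w ! i \<noteq> w ! (Suc i mod length w))"
proof -
  have "(\<forall>i<length w. w ! i \<noteq> w ! (Suc i mod length w)) \<longleftrightarrow>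
    (\<forall>i<length w - 1. w ! i \<noteq> w ! (Suc i)) \<and> w ! (length w - 1) \<noteq> w ! 0"
  proof (intro iffI conjI allI impI)
    fix i assume *: "\<forall>i<length w. w ! i \<noteq> w ! (Suc i mod length w)"
    show "w ! i \<noteq> w ! (Suc i)" if "i < length w - 1" for i using *[rule_format, of i] that by simp
    show "w ! (length w - 1) \<noteq> w ! 0" using *[rule_format, of "length w - 1"] assms by simp
  next
    fix i assume *: "(\<forall>i<length w - 1. w ! i \<noteq> w ! (Suc i)) \<and> w ! (length w - 1) \<noteq> w ! 0"
      "i < length w"
    show "w ! i \<noteq> w ! (Suc i mod length w)"
    proof (cases "i = length w - 1")
      case True
      then have "Suc i = length w" using *(2) by linarith
      then have "Suc i mod length w = 0" by simp
      then show ?thesis using *(1) True by metis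
    next
      case False
      then have "Suc i < length w" using * by simp
      then show ?thesis using * by simp
    qed
  qed
  then show ?thesis
    using assms by (auto simp: distinct_adj_conv_nth hd_conv_nth last_conv_nth)
qed

text \<open>A single rotation suffices, by induction: step \<open>i\<close> of
  \<open>rotate1 ws\<close> is step \<open>Suc i mod length ws\<close> of \<open>ws\<close>.\<close>

lemma closed_walk_edges_rotate: "closed_walk_edges (rotate k vs) = closed_walk_edges vs"
proof (induction k)
  case (Suc k)
  have "closed_walk_edges (rotate1 ws) \<subseteq> closed_walk_edges ws" for ws :: "'a list"
  proof (cases "ws = []")
    case False
    show ?thesis
    proof
      fix e assume "e \<in> closed_walk_edges (rotate1 ws)"
      then obtain i where i: "i < length ws" "e = {rotate1 ws ! i, rotate1 ws ! (Suc i mod length ws)}"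
        by (auto simp: closed_walk_edges_def)
      have lt: "Suc j mod length ws < length ws" for j using False by simp
      show "e \<in> closed_walk_edges ws"
        unfolding closed_walk_edges_def using i lt[of i]
        by (auto simp: nth_rotate1 intro!: exI[of _ "Suc i mod length ws"])
    qed
  qed (simp add: closed_walk_edges_def)
  moreover have "closed_walk_edges ws \<subseteq> closed_walk_edges (rotate1 ws)" for ws :: "'a list"
  proof
    fix e assume "e \<in> closed_walk_edges ws"
    then obtain i where i: "i < length ws" "e = {ws ! i, ws ! (Suc i mod length ws)}"
      by (auto simp: closed_walk_edges_def)
    \<comment> \<open>The cyclic predecessor of \<open>i\<close>, which is where step
      \<open>i\<close> of \<open>ws\<close> occurs in \<open>rotate1 ws\<close>.\<close>
    define j where "j = (if i = 0 then length ws - 1 else i - 1)"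
    have j: "j < length ws" "Suc j mod length ws = i" using i by (auto simp: j_def)
    have "Suc (Suc j mod length ws) mod length ws = Suc i mod length ws" using j by simp
    then show "e \<in> closed_walk_edges (rotate1 ws)"
      unfolding closed_walk_edges_def using i j
      by (auto simp: nth_rotate1 intro!: exI[of _ j])
  qed
  ultimately show ?case using Suc by (metis rotate_Suc subset_antisym)
qed simp

text \<open>Reversal traverses the same steps backwards and keeps the closing step last. One
  inclusion is enough, since \<open>rev\<close> is an involution.\<close>

lemma closed_walk_edges_rev: "closed_walk_edges (rev vs) = closed_walk_edges vs"
proof -
  have sub: "closed_walk_edges (rev ws) \<subseteq> closed_walk_edges ws" for ws :: "'a list"
  proof
    fix e assume "e \<in> closed_walk_edges (rev ws)"
    then obtain i where i: "i < length ws" "e = {rev ws ! i, rev ws ! (Suc i mod length ws)}"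
      by (auto simp: closed_walk_edges_def)
    show "e \<in> closed_walk_edges ws"
    proof (cases "Suc i = length ws")
      case True
      then have "e = {ws ! i, ws ! (Suc i mod length ws)}"
        using i by (simp add: rev_nth insert_commute flip: True)
      then show ?thesis using i(1) unfolding closed_walk_edges_def by blast
    next
      case False
      then have *: "Suc i < length ws" using i by simp
      \<comment> \<open>Entries \<open>i\<close> and \<open>Suc i\<close> of \<open>rev ws\<close>
        are entries \<open>Suc j\<close> and \<open>j\<close> of \<open>ws\<close>.\<close>
      define j where "j = length ws - Suc (Suc i)"
      have j: "j < length ws" "Suc j < length ws" "length ws - Suc i = Suc j"
        using * by (auto simp: j_def)
      have "e = {ws ! j, ws ! (Suc j mod length ws)}"
        using i * j by (simp add: rev_nth insert_commute flip: j_def)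
      then show ?thesis using j(1) unfolding closed_walk_edges_def by blast
    qed
  qed
  show ?thesis using sub[of vs] sub[of "rev vs"] by auto
qed

text \<open>Degree two forces the continuation: of the two neighbours of the current vertex, one has
  just been visited, so the next vertex is the other one.\<close>

lemma closed_walk_eqI:
  assumes vs: "distinct vs" "3 \<le> length vs" and ws: "distinct ws" "length ws = length vs"
    and set: "set ws = set vs"
    and edges: "closed_walk_edges ws = closed_walk_edges vs"
    and start: "ws ! 0 = vs ! 0" "ws ! 1 = vs ! 1"
  shows "ws = vs"
proof -
  let ?N = "length vs"
  \<comment> \<open>The induction carries two consecutive positions, since the next vertex depends
    on the current one and on the one before.\<close>
  have "Suc k < ?N \<longrightarrow> ws ! k = vs ! k \<and> ws ! Suc k = vs ! Suc k" for k
  proof (induction k)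
    case 0
    then show ?case using start by simp
  next
    case (Suc k)
    show ?case
    proof
      assume k: "Suc (Suc k) < ?N"
      then have IH: "ws ! k = vs ! k" "ws ! Suc k = vs ! Suc k" using Suc by auto
      obtain j where j: "j < ?N" "ws ! Suc (Suc k) = vs ! j"
        using set k ws by (metis in_set_conv_nth)
      have "{ws ! Suc k, ws ! Suc (Suc k)} \<in> closed_walk_edges ws"
        using k ws by (subst mem_closed_walk_edges_iff) auto
      then have "{vs ! Suc k, vs ! j} \<in> closed_walk_edges vs" using IH j edges by simp
      then have "j = Suc (Suc k) \<or> Suc k = Suc j mod ?N"
        using vs k j by (subst (asm) mem_closed_walk_edges_iff) auto
      \<comment> \<open>A wrap-around would give \<open>Suc k = 0\<close>, so the predecessor case
        is the vertex just left.\<close>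
      moreover have "j = k" if "Suc k = Suc j mod ?N"
        using that j by (cases "Suc j = ?N") auto
      \<comment> \<open>Going back to \<open>vs ! k = ws ! k\<close> would repeat an entry of
        \<open>ws\<close>.\<close>
      moreover have "j \<noteq> k"
        using IH(1) j k ws nth_eq_iff_index_eq[of ws "Suc (Suc k)" k] by auto
      ultimately have "j = Suc (Suc k)" by blast
      then show "ws ! Suc k = vs ! Suc k \<and> ws ! Suc (Suc k) = vs ! Suc (Suc k)"
        using IH j by simp
    qed
  qed
  then have step: "Suc k < ?N \<Longrightarrow> ws ! k = vs ! k \<and> ws ! Suc k = vs ! Suc k" for k by blast
  show ?thesis
  proof (rule nth_equalityI)
    fix i assume "i < length ws"
    then show "ws ! i = vs ! i" using step[of "i - 1"] start ws by (cases i) auto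
  qed (use ws in simp)
qed

section \<open>Counting the traversals of one cycle\<close>

lemma card_arcs:
  assumes "distinct vs" "3 \<le> length vs"
  shows "card {(u, v). {u, v} \<in> closed_walk_edges vs} = 2 * length vs"
proof -
  let ?N = "length vs"
  let ?f = "\<lambda>i. (vs ! i, vs ! (Suc i mod ?N))"
  let ?g = "\<lambda>i. (vs ! (Suc i mod ?N), vs ! i)"
  have lt: "Suc i mod ?N < ?N" for i using assms(2) by (intro mod_less_divisor) linarith
  have eq: "{(u, v). {u, v} \<in> closed_walk_edges vs} = ?f ` {..<?N} \<union> ?g ` {..<?N}"
    by (auto simp: closed_walk_edges_def doubleton_eq_iff)
  have inj: "inj_on ?f {..<?N}" "inj_on ?g {..<?N}"
    using assms(1) by (auto simp: inj_on_def nth_eq_iff_index_eq)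
  \<comment> \<open>A common arc would make \<open>i\<close> and \<open>j\<close> cyclic successors
    of each other, forcing length at most 2. Here \<open>3 \<le> length vs\<close> is essential: on
    two vertices the forward and backward arcs coincide.\<close>
  have disj: "?f ` {..<?N} \<inter> ?g ` {..<?N} = {}"
  proof (rule equals0I)
    fix p assume "p \<in> ?f ` {..<?N} \<inter> ?g ` {..<?N}"
    then obtain i j where ij: "i < ?N" "j < ?N" "p = ?f i" "p = ?g j" by auto
    have wrap: "Suc k mod ?N = (if Suc k = ?N then 0 else Suc k)" if "k < ?N" for k
      using that by simp
    have "i = Suc j mod ?N" "j = Suc i mod ?N"
      using ij lt assms(1) by (metis nth_eq_iff_index_eq prod.inject)+
    then have "i = 0 \<and> Suc j = ?N \<or> i = Suc j" "j = 0 \<and> Suc i = ?N \<or> j = Suc i"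
      using ij(1,2) wrap by metis+
    then show False using assms(2) by (elim disjE conjE) linarith+
  qed
  show ?thesis unfolding eq
    using inj disj by (subst card_Un_disjoint) (auto simp: card_image)
qed

text \<open>Recording the first two vertices is a bijection from traversals to arcs:
  \<open>closed_walk_eqI\<close> gives injectivity, and rotating \<open>vs\<close> or its reversal
  reaches every arc.\<close>

lemma card_closed_walks_with_edges:
  assumes vs: "distinct vs" "3 \<le> length vs"
  shows "card {ws. distinct ws \<and> set ws = set vs \<and> closed_walk_edges ws = closed_walk_edges vs}
    = 2 * length vs" (is "card ?W = _")
proof -
  let ?N = "length vs"
  have len: "length ws = ?N" if "ws \<in> ?W" for ws
    using that vs by (metis (mono_tags, lifting) distinct_card mem_Collect_eq)
  \<comment> \<open>Rotating by \<open>i\<close> brings step \<open>i\<close> to the front.\<close>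
  have rot: "\<exists>us. distinct us \<and> set us = set ws \<and> closed_walk_edges us = closed_walk_edges ws
      \<and> us ! 0 = ws ! i \<and> us ! 1 = ws ! (Suc i mod length ws)"
    if "i < length ws" "3 \<le> length ws" "distinct ws" for ws :: "'a list" and i
  proof -
    have "0 < length ws" "1 < length ws" using that by linarith+
    then have "rotate i ws ! 0 = ws ! i" "rotate i ws ! 1 = ws ! (Suc i mod length ws)"
      using that(1) by (simp_all add: nth_rotate del: length_greater_0_conv)
    then show ?thesis using that(3) closed_walk_edges_rotate[of i ws]
      by (intro exI[of _ "rotate i ws"]) simp
  qed
  have "bij_betw (\<lambda>ws. (ws ! 0, ws ! 1)) ?W {(u, v). {u, v} \<in> closed_walk_edges vs}"
    unfolding bij_betw_def
  proof (intro conjI equalityI subsetI)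
    show "inj_on (\<lambda>ws. (ws ! 0, ws ! 1)) ?W"
    proof (rule inj_onI)
      fix us ws assume *: "us \<in> ?W" "ws \<in> ?W" "(us ! 0, us ! 1) = (ws ! 0, ws ! 1)"
      show "us = ws"
        by (rule closed_walk_eqI) (use * len[of us] len[of ws] vs in auto)
    qed
  next
    fix p assume "p \<in> (\<lambda>ws. (ws ! 0, ws ! 1)) ` ?W"
    then obtain ws where ws: "ws \<in> ?W" "p = (ws ! 0, ws ! 1)" by blast
    have "{ws ! 0, ws ! 1} \<in> closed_walk_edges ws"
      using ws len[OF ws(1)] vs by (subst mem_closed_walk_edges_iff) auto
    then show "p \<in> {(u, v). {u, v} \<in> closed_walk_edges vs}" using ws by simp
  next
    fix p assume "p \<in> {(u, v). {u, v} \<in> closed_walk_edges vs}"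
    then obtain u v where p: "p = (u, v)" "{u, v} \<in> closed_walk_edges vs" by blast
    then obtain i where i: "i < ?N" "{u, v} = {vs ! i, vs ! (Suc i mod ?N)}"
      by (auto simp: closed_walk_edges_def)
    \<comment> \<open>The arc is a step of \<open>vs\<close> itself or, if oriented the other way,
      of \<open>rev vs\<close>.\<close>
    have "\<exists>ws i. i < length ws \<and> distinct ws \<and> set ws = set vs
        \<and> closed_walk_edges ws = closed_walk_edges vs
        \<and> u = ws ! i \<and> v = ws ! (Suc i mod length ws)"
    proof (cases "u = vs ! i")
      case True
      then show ?thesis using i vs by (intro exI[of _ vs] exI[of _ i]) (auto simp: doubleton_eq_iff)
    next
      case False
      then have uv: "v = vs ! i" "u = vs ! (Suc i mod ?N)" using i by (auto simp: doubleton_eq_iff)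
      have "0 < ?N" using vs by linarith
      \<comment> \<open>Entry \<open>p\<close> of \<open>vs\<close> is entry
        \<open>?N - Suc p\<close> of \<open>rev vs\<close>; here \<open>p\<close> is the index of
        \<open>u\<close>.\<close>
      define k where "k = ?N - Suc (Suc i mod ?N)"
      have k: "k < ?N" using \<open>0 < ?N\<close> by (simp add: k_def)
      have 1: "rev vs ! k = u"
        using \<open>0 < ?N\<close> by (simp add: k_def uv rev_nth Suc_diff_Suc)
      have 2: "rev vs ! (Suc k mod ?N) = v"
      proof (cases "Suc i = ?N")
        \<comment> \<open>For the closing edge, \<open>k\<close> is the last index of
          \<open>rev vs\<close>, so its successor wraps to 0.\<close>
        case True
        then have "Suc k = ?N" by (simp add: k_def)
        then show ?thesis using \<open>0 < ?N\<close> by (simp add: uv rev_nth flip: True)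
      next
        case False
        then have "Suc k = ?N - Suc i" "0 < Suc k" using i(1) by (auto simp: k_def)
        then show ?thesis using i(1) by (simp add: uv rev_nth)
      qed
      show ?thesis
        using vs k 1 2 by (intro exI[of _ "rev vs"] exI[of _ k]) (auto simp: closed_walk_edges_rev)
    qed
    then obtain ws i where ws: "i < length ws" "distinct ws" "set ws = set vs"
        "closed_walk_edges ws = closed_walk_edges vs" "u = ws ! i" "v = ws ! (Suc i mod length ws)"
      by blast
    moreover have "length ws = ?N" using len[of ws] ws by simp
    ultimately show "p \<in> (\<lambda>ws. (ws ! 0, ws ! 1)) ` ?W"
      using rot[of i ws] vs p by (auto simp: image_iff)
  qed
  then show ?thesis using bij_betw_same_card card_arcs[OF vs] by fastforce
qed

section \<open>Rooted, directed traversals against Hamiltonian cycles\<close>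

definition closed_walks :: "'a set \<Rightarrow> 'a set set \<Rightarrow> 'a list set" where
  "closed_walks V E = {vs. distinct vs \<and> set vs = V \<and> closed_walk_edges vs \<subseteq> E}"

lemma finite_closed_walks:
  assumes "finite V"
  shows "finite (closed_walks V E)"
proof (rule finite_subset)
  show "closed_walks V E \<subseteq> {xs. set xs \<subseteq> V \<and> length xs = card V}"
    by (auto simp: closed_walks_def distinct_card)
qed (use assms finite_lists_length_eq in blast)

text \<open>Sending a traversal to its edge set maps onto the Hamiltonian cycles, and all fibres
  have the same size \<open>2 * card V\<close>.\<close>

lemma card_closed_walks_cycles:
  assumes "finite V" "3 \<le> card V"
  shows "card (closed_walks V E) = 2 * card V * num_hamiltonian_cycles V E"
proof -
  let ?C = "{C. hamiltonian_cycle V E C}"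
  let ?fibre = "\<lambda>C. {vs \<in> closed_walks V E. closed_walk_edges vs = C}"
  have fin: "finite (closed_walks V E)" using assms(1) by (rule finite_closed_walks)
  \<comment> \<open>A distinct list with vertex set \<open>V\<close> has length
    \<open>card V\<close>, so \<open>3 \<le> card V\<close> supplies the length bound in
    \<open>hamiltonian_cycle\<close>.\<close>
  have C: "?C = closed_walk_edges ` closed_walks V E"
    using assms by (auto simp: hamiltonian_cycle_def closed_walks_def distinct_card)
  have fibre: "card (?fibre C) = 2 * card V" if C_cycle: "C \<in> ?C" for C
  proof -
    obtain vs where vs: "3 \<le> length vs" "distinct vs" "set vs = V" "C = closed_walk_edges vs" "C \<subseteq> E"
      using C_cycle unfolding hamiltonian_cycle_def by blast
    have "?fibre C =
        {ws. distinct ws \<and> set ws = set vs \<and> closed_walk_edges ws = closed_walk_edges vs}"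
      using vs by (auto simp: closed_walks_def)
    then show ?thesis using card_closed_walks_with_edges[OF vs(2,1)] vs(3,4) distinct_card[OF vs(2)] by simp
  qed
  have "closed_walks V E = (\<Union>C\<in>?C. ?fibre C)" unfolding C by auto
  then have "card (closed_walks V E) = card (\<Union>C\<in>?C. ?fibre C)" by simp
  also have "\<dots> = (\<Sum>C\<in>?C. card (?fibre C))"
    using fin by (intro card_UN_disjoint) (auto simp: C)
  finally show ?thesis using fibre by (simp add: num_hamiltonian_cycles_def)
qed

section \<open>Traversals of the complete multipartite graph and colour words\<close>

lemma closed_walks_multipartite_iff:
  assumes "vs \<noteq> []" "distinct vs" "set vs = multipartite_verts m n"
  shows "closed_walk_edges vs \<subseteq> complete_multipartite_edges m n \<longleftrightarrow>
    map fst vs \<in> cyclic_proper_words m n"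
proof -
  let ?V = "multipartite_verts m n" and ?w = "map fst vs"
  have "0 < length vs" using assms(1) by simp
  then have lt: "Suc i mod length vs < length vs" for i by simp
  have E: "{u, v} \<in> complete_multipartite_edges m n \<longleftrightarrow> fst u \<noteq> fst v"
    if "u \<in> ?V" "v \<in> ?V" for u v
    using that unfolding complete_multipartite_edges_def mem_Collect_eq doubleton_eq_iff by metis
  have "closed_walk_edges vs \<subseteq> complete_multipartite_edges m n \<longleftrightarrow>
      (\<forall>i<length vs. {vs ! i, vs ! (Suc i mod length vs)} \<in> complete_multipartite_edges m n)"
    by (auto simp: closed_walk_edges_def)
  \<comment> \<open>Adjacency depends only on the colours, so the condition passes from
    \<open>vs\<close> to its colour word.\<close>
  also have "\<dots> \<longleftrightarrow> (\<forall>i<length ?w. ?w ! i \<noteq> ?w ! (Suc i mod length ?w))"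
    using E lt assms(3) nth_mem[of _ vs] by simp
  also have "\<dots> \<longleftrightarrow> distinct_adj ?w \<and> hd ?w \<noteq> last ?w"
    using assms(1) by (subst distinct_adj_hd_last_iff) auto
  \<comment> \<open>The length, alphabet and count conditions hold automatically, since
    \<open>vs\<close> lists every vertex exactly once.\<close>
  also have "\<dots> \<longleftrightarrow> ?w \<in> cyclic_proper_words m n"
  proof -
    have "length ?w = (\<Sum>i=1..m. n i)"
      using distinct_card[OF assms(2)] by (simp add: assms(3) multipartite_verts_def)
    moreover have "set ?w \<subseteq> {1..m}"
      unfolding set_map assms(3) multipartite_verts_def by auto
    moreover have "count_list ?w i = n i" if "i \<in> {1..m}" for i
      using count_list_map_fst[OF assms(2) assms(3)[unfolded multipartite_verts_def] that] by simp
    ultimately show ?thesis by (auto simp: cyclic_proper_words_def)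
  qed
  finally show ?thesis .
qed

text \<open>The traversals are fibred over their colour words by \<open>map fst\<close>, and the
  fibre over \<open>w\<close> is the set of its lifts, of a size independent of
  \<open>w\<close>.\<close>

lemma card_closed_walks_words:
  assumes "multipartite_verts m n \<noteq> {}"
  shows "card (closed_walks (multipartite_verts m n) (complete_multipartite_edges m n)) =
    (\<Prod>i=1..m. fact (n i)) * card (cyclic_proper_words m n)"
proof -
  let ?W = "cyclic_proper_words m n"
  let ?L = "lifts {1..m} (\<lambda>i. {..<n i})"
  have "closed_walks (multipartite_verts m n) (complete_multipartite_edges m n) = (\<Union>w\<in>?W. ?L w)"
  proof -
    \<comment> \<open>A nonempty vertex set rules out \<open>[]\<close>, whose \<open>hd\<close> and
      \<open>last\<close> are unspecified.\<close>
    have "vs \<in> closed_walks (multipartite_verts m n) (complete_multipartite_edges m n) \<longleftrightarrow>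
        distinct vs \<and> set vs = multipartite_verts m n \<and> map fst vs \<in> ?W" for vs
      using closed_walks_multipartite_iff[of vs m n] assms
      by (cases "vs = []") (auto simp: closed_walks_def)
    then show ?thesis by (auto simp: lifts_def multipartite_verts_def)
  qed
  also have "card \<dots> = (\<Sum>w\<in>?W. card (?L w))"
  proof (rule card_UN_disjoint)
    show "finite ?W"
      by (rule finite_subset[OF _ finite_lists_length_eq[of "{1..m}" "\<Sum>i=1..m. n i"]])
        (auto simp: cyclic_proper_words_def)
    show "\<forall>w\<in>?W. finite (?L w)" by (auto intro!: finite_lifts)
  qed (auto simp: lifts_def)
  also have "\<dots> = (\<Sum>w\<in>?W. \<Prod>i=1..m. fact (n i))"
  proof (rule sum.cong)
    fix w assume "w \<in> ?W"
    then show "card (?L w) = (\<Prod>i=1..m. fact (n i))"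
      by (subst card_lifts) (auto simp: cyclic_proper_words_def)
  qed simp
  finally show ?thesis by simp
qed

text \<open>Both counts of the traversals are equated. Under the first two assumptions,
  \<open>3 \<le> N\<close> excludes only K_{1,1}: it has no cycle on three or more vertices, while
  its two words would give the value 1/2.\<close>

theorem mainTheorem7:
  fixes m N :: nat and n :: "nat \<Rightarrow> nat"
  assumes "2 \<le> m"
    and "\<forall>i\<in>{1..m}. 1 \<le> n i"
    and "N = (\<Sum>i=1..m. n i)"
    and "3 \<le> N"
  shows "real (num_hamiltonian_cycles (multipartite_verts m n) (complete_multipartite_edges m n)) =
    (\<Prod>i=1..m. fact (n i)) / (2 * real N) * real (card (cyclic_proper_words m n))"
proof -
  let ?V = "multipartite_verts m n" and ?E = "complete_multipartite_edges m n"
  have V: "finite ?V" "card ?V = N" using assms(3) by (auto simp: multipartite_verts_def)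
  then have "?V \<noteq> {}" using assms(4) by auto
  then have "2 * N * num_hamiltonian_cycles ?V ?E =
      (\<Prod>i=1..m. fact (n i)) * card (cyclic_proper_words m n)"
    using card_closed_walks_cycles[of ?V ?E] card_closed_walks_words[of m n] V assms(4) by simp
  \<comment> \<open>The identity is division-free over the naturals; only after the cast to reals is
    it divided by \<open>2 * N\<close>.\<close>
  then have "real (2 * N * num_hamiltonian_cycles ?V ?E) =
      real ((\<Prod>i=1..m. fact (n i)) * card (cyclic_proper_words m n))"
    by (rule arg_cong)
  then show ?thesis using assms(4) by (simp add: field_simps of_nat_prod)
qed

end
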